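(* Let $m\ge 2$ be an integer and let $g\colon[0,1]\to\mathbb{R}$ be continuous. Then there is a unique function $u\colon\mathbb{T}_m\to\mathbb{R}$ satisfying $$u(x)=\min\left\{\min_{\substack{y,z\in\mathcal{S}(x)\\ y\neq z}}\frac{u(y)+u(z)}{2}\;;\;\min_{y\in\mathcal{S}(x)}\frac{u(\hat{x})+m\,u(y)}{m+1}\right\}\qquad\text{for all }x\in\mathbb{T}_m$$ and $$\lim_{x\to\pi}u(x)=g(\psi(\pi))\qquad\text{for all }\pi\in\partial\mathbb{T}_m.$$ (For $x=\emptyset$ the equation is understood as $u(\emptyset)=\min_{y,z\in\mathcal{S}(\emptyset),\,y\ne z}\frac{u(y)+u(z)}{2}$.)
   Context: Tree. For an integer $m\ge2$, $\mathbb{T}_m$ is the infinite $m$-branching tree whose vertices are the root $\emptyset$ and all finite sequences $(a_1,\dots,a_k)$, $k\ge1$, with $a_i\in\{0,\dots,m-1\}$. The successors of $x$ are $\mathcal{S}(x)=\{(x,i): i\in\{0,\dots,m-1\}\}$. If $x\ne\emptyset$, $\hat{x}$ denotes its unique immediate predecessor. Boundary. A branch is an infinite sequence of vertices, each followed by one of its successors, identified with $\pi=(a_1,a_2,\dots)$, $a_k\in\{0,\dots,m-1\}$; $\partial\mathbb{T}_m$ is the set of all branches. Define $\psi(\pi)=\sum_{k=1}^{\infty}a_k m^{-k}\in[0,1]$. For $u\colon\mathbb{T}_m\to\mathbb{R}$ and $\pi=(a_1,a_2,\dots)$, $\lim_{x\to\pi}u(x)$ is the limit of $u(x_k)$ as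 $k\to\infty$, where $x_k=(a_1,\dots,a_k)$. *)

theory Defs
  imports "HOL-Analysis.Analysis"
begin

text \<open>The vertex $(a_1,\dots,a_k)$ is the list \<open>[a\<^sub>1, \<dots>, a\<^sub>k]\<close>, the root is \<open>[]\<close>.\<close>

definition m_tree :: "nat \<Rightarrow> nat list set" where
  "m_tree m = lists {..<m}"

definition successors :: "nat \<Rightarrow> nat list \<Rightarrow> nat list set" where
  "successors m x = {x @ [i] | i. i < m}"

definition predecessor :: "nat list \<Rightarrow> nat list" where
  "predecessor x = butlast x"

text \<open>A branch $(a_1,a_2,\dots)$ is a sequence indexed from 0, so \<open>p k\<close> is $a_{k+1}$.\<close>

definition boundary :: "nat \<Rightarrow> (nat \<Rightarrow> nat) set" where
  "boundary m = UNIV \<rightarrow> {..<m}"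

definition branch_vertex :: "(nat \<Rightarrow> nat) \<Rightarrow> nat \<Rightarrow> nat list" where
  "branch_vertex p k = map p [0..<k]"

definition psi :: "nat \<Rightarrow> (nat \<Rightarrow> nat) \<Rightarrow> real" where
  "psi m p = (\<Sum>k. real (p k) / real m ^ Suc k)"

definition pair_min :: "nat \<Rightarrow> (nat list \<Rightarrow> real) \<Rightarrow> nat list \<Rightarrow> real" where
  "pair_min m u x =
     Min {(u y + u z) / 2 | y z. y \<in> successors m x \<and> z \<in> successors m x \<and> y \<noteq> z}"

definition pred_min :: "nat \<Rightarrow> (nat list \<Rightarrow> real) \<Rightarrow> nat list \<Rightarrow> real" where
  "pred_min m u x =
     Min {(u (predecessor x) + real m * u y) / (real m + 1) | y. y \<in> successors m x}"

text \<open>The root has no predecessor, so there the second minimum is dropped.\<close>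

definition satisfies_equation :: "nat \<Rightarrow> (nat list \<Rightarrow> real) \<Rightarrow> bool" where
  "satisfies_equation m u \<longleftrightarrow>
     (\<forall>x \<in> m_tree m. u x =
        (if x = [] then pair_min m u x else min (pair_min m u x) (pred_min m u x)))"

definition attains_boundary_values ::
    "nat \<Rightarrow> (real \<Rightarrow> real) \<Rightarrow> (nat list \<Rightarrow> real) \<Rightarrow> bool" where
  "attains_boundary_values m g u \<longleftrightarrow>
     (\<forall>p \<in> boundary m. (\<lambda>k. u (branch_vertex p k)) \<longlonglongrightarrow> g (psi m p))"

end

theory Submission
  imports Defs "HOL-Library.Sublist"
begin

text \<open>
  Give the edge between levels \<open>k\<close> and \<open>k + 1\<close> the length \<open>m\<^sup>-\<^sup>k\<close>, up to a common factor. Then both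
  kinds of average in the equation are linear interpolations at \<open>x\<close> along a geodesic through two
  neighbours of \<open>x\<close>, and \<open>u \<le> T u\<close>, where \<open>T\<close> (\<open>tree_op\<close>) is the right-hand side, says that \<open>u\<close> is
  convex along geodesics. The solution is the convex envelope of the boundary data.

  Uniqueness is a comparison principle. Let \<open>u \<le> T u\<close>, \<open>T v \<le> v\<close> and \<open>w = u - v\<close>. The minimum
  \<open>T v x\<close> is attained at one of the averages, and the same average applied to \<open>w\<close> is at least \<open>w x\<close>.
  Hence, unless \<open>w\<close> is larger at the parent than at \<open>x\<close>, some child of \<open>x\<close> has \<open>w\<close> at least \<open>w x\<close>
  (\<open>excess_propagates_downwards\<close>), and the situation repeats at this child. If \<open>w\<close> is positive
  anywhere, then the first vertex with \<open>w > 0\<close> on the way from the root starts a branch along which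
  \<open>w\<close> does not decrease, so \<open>u\<close> and \<open>v\<close> cannot have the same limit there.

  Existence follows from Perron's method: \<open>u\<close> is the supremum of all \<open>v \<le> T v\<close> that lie below every
  upper barrier, and \<open>T u = u\<close> by the Knaster-Tarski argument, since \<open>T\<close> is monotone. The barriers are
  explicit. The function that vanishes off the subtree of a vertex \<open>a\<close> and equals the distance to \<open>a\<close>
  in it, scaled to tend to 1 at the boundary, is convex. Multiplied by \<open>D \<ge> 0\<close> and added to a constant
  it bounds \<open>u\<close> from below, subtracted from a constant it bounds \<open>u\<close> from above
  (\<open>exists_solution_between_barriers\<close>). When \<open>a\<close> is far along a branch \<open>p\<close>, the boundary data vary
  little on the subtree of \<open>a\<close>, so the two bounds squeeze \<open>u\<close> towards the boundary value at \<open>p\<close>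
  (\<open>between_barriers_boundary_limit\<close>). The continuity used here is that in the
  topology of cylinders, which \<open>g \<circ> \<psi>\<close> inherits from \<open>g\<close> because \<open>\<psi>\<close> varies by at most \<open>m\<^sup>-\<^sup>k\<close>
  among branches that share their first \<open>k\<close> digits.
\<close>

section \<open>The operator on the right-hand side\<close>

definition tree_op :: "nat \<Rightarrow> (nat list \<Rightarrow> real) \<Rightarrow> nat list \<Rightarrow> real" where
  "tree_op m u x = (if x = [] then pair_min m u x else min (pair_min m u x) (pred_min m u x))"

definition subsolution :: "nat \<Rightarrow> (nat list \<Rightarrow> real) \<Rightarrow> bool" where
  "subsolution m u \<longleftrightarrow> (\<forall>x \<in> m_tree m. u x \<le> tree_op m u x)"

definition supersolution :: "nat \<Rightarrow> (nat list \<Rightarrow> real) \<Rightarrow> bool" where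
  "supersolution m u \<longleftrightarrow> (\<forall>x \<in> m_tree m. tree_op m u x \<le> u x)"

text \<open>The distance to \<open>a\<close> in the subtree below \<open>a\<close>, for edge lengths that shrink by the factor \<open>m\<close>
  per level and are scaled so that the boundary is at distance 1.\<close>

definition subtree_ramp :: "nat \<Rightarrow> nat list \<Rightarrow> nat list \<Rightarrow> real" where
  "subtree_ramp m a x = (if prefix a x then 1 - 1 / real m ^ (length x - length a) else 0)"

definition passes_through :: "(nat \<Rightarrow> nat) \<Rightarrow> nat list \<Rightarrow> bool" where
  "passes_through q a \<longleftrightarrow> branch_vertex q (length a) = a"

text \<open>Both bounds on \<open>f\<close> compare it with the limits of the function at the boundary, which are \<open>M - D\<close>
  on the branches through \<open>a\<close> and \<open>M\<close> on all others. Lower barriers are the mirror image.\<close>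

definition upper_barriers :: "nat \<Rightarrow> ((nat \<Rightarrow> nat) \<Rightarrow> real) \<Rightarrow> (nat list \<Rightarrow> real) set" where
  "upper_barriers m f = {\<lambda>x. M - D * subtree_ramp m a x | M D a. 0 \<le> D \<and>
     (\<forall>q \<in> boundary m. f q \<le> M \<and> (passes_through q a \<longrightarrow> f q \<le> M - D))}"

definition lower_barriers :: "nat \<Rightarrow> ((nat \<Rightarrow> nat) \<Rightarrow> real) \<Rightarrow> (nat list \<Rightarrow> real) set" where
  "lower_barriers m f = {\<lambda>x. C + D * subtree_ramp m a x | C D a. 0 \<le> D \<and>
     (\<forall>q \<in> boundary m. C \<le> f q \<and> (passes_through q a \<longrightarrow> C + D \<le> f q))}"

lemma satisfies_equation_iff_fixed_point:
  "satisfies_equation m u \<longleftrightarrow> (\<forall>x \<in> m_tree m. u x = tree_op m u x)"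
  by (simp add: satisfies_equation_def tree_op_def)

lemma root_in_m_tree: "[] \<in> m_tree m"
  by (simp add: m_tree_def)

lemma child_in_m_tree: "x \<in> m_tree m \<Longrightarrow> i < m \<Longrightarrow> x @ [i] \<in> m_tree m"
  by (auto simp: m_tree_def)

lemma parent_in_m_tree: "x \<in> m_tree m \<Longrightarrow> butlast x \<in> m_tree m"
  by (auto simp: m_tree_def dest: in_set_butlastD)

lemma branch_vertex_in_m_tree: "p \<in> boundary m \<Longrightarrow> branch_vertex p k \<in> m_tree m"
  by (auto simp: m_tree_def branch_vertex_def boundary_def Pi_iff)

lemma prefix_branch_vertex: "k \<le> n \<Longrightarrow> prefix (branch_vertex p k) (branch_vertex p n)"
  unfolding branch_vertex_def by (metis map_mono_prefix upt_add_eq_append le_add_diff_inverse le0 prefixI)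

lemma passes_through_prefix:
  assumes "passes_through q x" "prefix a x"
  shows "passes_through q a"
proof -
  have "prefix (branch_vertex q (length a)) x"
    using prefix_branch_vertex[of "length a" "length x" q] assms
    by (simp add: passes_through_def prefix_length_le)
  moreover have "length (branch_vertex q (length a)) = length a"
    by (simp add: branch_vertex_def)
  ultimately show ?thesis
    using assms(2) by (auto simp: passes_through_def prefix_def)
qed

context
  fixes m :: nat
  assumes m: "m \<ge> 2"
begin

text \<open>The vertex is continued with the digit 0.\<close>

lemma exists_branch_through:
  assumes "x \<in> m_tree m"
  obtains q where "q \<in> boundary m" "passes_through q x"
proof
  let ?q = "\<lambda>i. if i < length x then x ! i else 0"
  show "?q \<in> boundary m"
    using assms m by (auto simp: boundary_def m_tree_def in_lists_conv_set)
  show "passes_through ?q x"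
    by (auto simp: passes_through_def branch_vertex_def intro: nth_equalityI)
qed

lemma pair_min_eq_Min_image:
  "pair_min m u x = Min ((\<lambda>(i, j). (u (x @ [i]) + u (x @ [j])) / 2) `
     {(i, j). i < m \<and> j < m \<and> i \<noteq> j})"
  unfolding pair_min_def
proof (rule arg_cong[of _ _ Min], intro set_eqI iffI)
  fix c assume "c \<in> (\<lambda>(i, j). (u (x @ [i]) + u (x @ [j])) / 2) `
     {(i, j). i < m \<and> j < m \<and> i \<noteq> j}"
  then obtain i j where "i < m" "j < m" "i \<noteq> j" "c = (u (x @ [i]) + u (x @ [j])) / 2"
    by auto
  then show "c \<in> {(u y + u z) / 2 | y z. y \<in> successors m x \<and> z \<in> successors m x \<and> y \<noteq> z}"
    by (intro CollectI exI[of _ "x @ [i]"] exI[of _ "x @ [j]"]) (auto simp: successors_def)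
qed (auto simp: successors_def image_iff)

lemma pred_min_eq_Min_image:
  "pred_min m u x = Min ((\<lambda>i. (u (butlast x) + real m * u (x @ [i])) / (real m + 1)) ` {..<m})"
  unfolding pred_min_def
  by (rule arg_cong[of _ _ Min]) (auto simp: successors_def predecessor_def)

lemma finite_index_pairs: "finite {(i, j). i < m \<and> j < m \<and> i \<noteq> j}"
  by (rule finite_subset[of _ "{..<m} \<times> {..<m}"]) auto

lemma index_pairs_nonempty: "{(i, j). i < m \<and> j < m \<and> i \<noteq> j} \<noteq> {}"
proof -
  have "(0, 1) \<in> {(i, j). i < m \<and> j < m \<and> i \<noteq> j}" using m by auto
  then show ?thesis by blast
qed

lemma tree_op_ge_iff:
  "c \<le> tree_op m u x \<longleftrightarrow>
     (\<forall>i<m. \<forall>j<m. i \<noteq> j \<longrightarrow> c \<le> (u (x @ [i]) + u (x @ [j])) / 2) \<and>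
     (x \<noteq> [] \<longrightarrow> (\<forall>i<m. c \<le> (u (butlast x) + real m * u (x @ [i])) / (real m + 1)))"
proof -
  have "c \<le> pair_min m u x \<longleftrightarrow>
      (\<forall>i<m. \<forall>j<m. i \<noteq> j \<longrightarrow> c \<le> (u (x @ [i]) + u (x @ [j])) / 2)"
    unfolding pair_min_eq_Min_image
    by (subst Min_ge_iff) (use finite_index_pairs index_pairs_nonempty in auto)
  moreover have "c \<le> pred_min m u x \<longleftrightarrow>
      (\<forall>i<m. c \<le> (u (butlast x) + real m * u (x @ [i])) / (real m + 1))"
    unfolding pred_min_eq_Min_image
    using m by (subst Min_ge_iff) (auto simp: lessThan_empty_iff)
  ultimately show ?thesis by (cases "x = []") (simp_all add: tree_op_def)
qed

lemma tree_op_le_pair: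
  "i < m \<Longrightarrow> j < m \<Longrightarrow> i \<noteq> j \<Longrightarrow> tree_op m u x \<le> (u (x @ [i]) + u (x @ [j])) / 2"
  using tree_op_ge_iff[of "tree_op m u x" u x] by simp

lemma tree_op_le_pred:
  "i < m \<Longrightarrow> x \<noteq> [] \<Longrightarrow>
    tree_op m u x \<le> (u (butlast x) + real m * u (x @ [i])) / (real m + 1)"
  using tree_op_ge_iff[of "tree_op m u x" u x] by simp

lemma tree_op_attained:
  obtains (pair) i j where "i < m" "j < m" "i \<noteq> j"
      "tree_op m u x = (u (x @ [i]) + u (x @ [j])) / 2"
  | (pred) i where "i < m" "x \<noteq> []"
      "tree_op m u x = (u (butlast x) + real m * u (x @ [i])) / (real m + 1)"
proof -
  have "tree_op m u x = pair_min m u x \<or> x \<noteq> [] \<and> tree_op m u x = pred_min m u x"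
    unfolding tree_op_def min_def by auto
  then consider "tree_op m u x = pair_min m u x" | "x \<noteq> []" "tree_op m u x = pred_min m u x"
    by blast
  then show thesis
  proof cases
    case 1
    have "pair_min m u x \<in> (\<lambda>(i, j). (u (x @ [i]) + u (x @ [j])) / 2) `
        {(i, j). i < m \<and> j < m \<and> i \<noteq> j}"
      unfolding pair_min_eq_Min_image
      by (rule Min_in) (use finite_index_pairs index_pairs_nonempty in auto)
    with 1 show thesis by (auto intro: pair)
  next
    case 2
    have "pred_min m u x
        \<in> (\<lambda>i. (u (butlast x) + real m * u (x @ [i])) / (real m + 1)) ` {..<m}"
      unfolding pred_min_eq_Min_image
      by (rule Min_in) (use m in \<open>auto simp: lessThan_empty_iff\<close>)
    with 2 show thesis by (auto intro: pred)
  qed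
qed

lemma tree_op_mono:
  assumes "x \<in> m_tree m" and le: "\<And>y. y \<in> m_tree m \<Longrightarrow> u y \<le> v y"
  shows "tree_op m u x \<le> tree_op m v x"
proof (cases rule: tree_op_attained[of v x])
  case (pair i j)
  then show ?thesis
    using tree_op_le_pair[of i j u x] le[OF child_in_m_tree, OF assms(1), of i]
      le[OF child_in_m_tree, OF assms(1), of j] by simp
next
  case (pred i)
  have "(u (butlast x) + real m * u (x @ [i])) / (real m + 1)
      \<le> (v (butlast x) + real m * v (x @ [i])) / (real m + 1)"
    using pred(1) le[OF child_in_m_tree, OF assms(1), of i]
      le[OF parent_in_m_tree, OF assms(1)]
    by (intro divide_right_mono add_mono mult_left_mono) auto
  with pred tree_op_le_pred[of i x u] show ?thesis by simp
qed

lemma tree_op_cong: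
  assumes "x \<in> m_tree m" and "\<And>y. y \<in> m_tree m \<Longrightarrow> u y = v y"
  shows "tree_op m u x = tree_op m v x"
  using assms by (intro antisym tree_op_mono) auto

section \<open>Comparison principle\<close>

text \<open>Apply to \<open>u\<close> the average that attains the minimum for \<open>v\<close>. An average of two children of \<open>x\<close>
  can only dominate the excess at \<open>x\<close> if one of them does. An average that involves the parent leaves
  the child as the only one that can do so, because the excess at the parent is no larger.\<close>

lemma excess_propagates_downwards:
  assumes "subsolution m u" "supersolution m v" and x: "x \<in> m_tree m"
    and rising: "x = [] \<or> u (butlast x) - v (butlast x) \<le> u x - v x"
  shows "\<exists>i<m. u x - v x \<le> u (x @ [i]) - v (x @ [i])"
proof -
  have u: "u x \<le> tree_op m u x" and v: "tree_op m v x \<le> v x"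
    using assms by (auto simp: subsolution_def supersolution_def)
  show ?thesis
  proof (cases rule: tree_op_attained[of v x])
    case (pair i j)
    have "u x \<le> (u (x @ [i]) + u (x @ [j])) / 2"
      using u tree_op_le_pair[OF pair(1-3)] by (rule order_trans)
    with pair v have "u x - v x \<le> u (x @ [i]) - v (x @ [i]) \<or>
        u x - v x \<le> u (x @ [j]) - v (x @ [j])" by argo
    with pair show ?thesis by blast
  next
    case (pred i)
    have "u x \<le> (u (butlast x) + real m * u (x @ [i])) / (real m + 1)"
      using u tree_op_le_pred[OF pred(1,2)] by (rule order_trans)
    moreover have "(v (butlast x) + real m * v (x @ [i])) / (real m + 1) \<le> v x"
      using pred(3) v by simp
    ultimately have "(real m + 1) * (u x - v x) \<le> (u (butlast x) - v (butlast x))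
        + real m * (u (x @ [i]) - v (x @ [i]))"
      by (simp add: field_simps)
    \<comment> \<open>The excess at the parent is at most one of the \<open>m + 1\<close> copies of the excess at \<open>x\<close>, and
        cancelling these two leaves \<open>m\<close> copies against the child.\<close>
    with rising pred(2) have "real m * (u x - v x) \<le> real m * (u (x @ [i]) - v (x @ [i]))"
      by (simp add: distrib_right)
    with m pred(1) show ?thesis by auto
  qed
qed

text \<open>Dependent choice gives an increasing chain of vertices below \<open>x\<close>. Its digits form the branch.\<close>

lemma exists_branch_following:
  assumes x: "x \<in> m_tree m" "Q x"
    and step: "\<And>y. y \<in> m_tree m \<Longrightarrow> Q y \<Longrightarrow> \<exists>i<m. Q (y @ [i])"
  obtains p where "p \<in> boundary m" "\<And>k. k \<ge> length x \<Longrightarrow> Q (branch_vertex p k)"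
proof -
  have "\<exists>y. \<forall>n. (y n \<in> m_tree m \<and> Q (y n) \<and> length (y n) = length x + n \<and> prefix x (y n)) \<and>
      (\<exists>i<m. y (Suc n) = y n @ [i])"
  proof (rule dependent_nat_choice)
    fix y n assume y: "y \<in> m_tree m \<and> Q y \<and> length y = length x + n \<and> prefix x y"
    then obtain i where "i < m" "Q (y @ [i])" using step by blast
    with y show "\<exists>z. (z \<in> m_tree m \<and> Q z \<and> length z = length x + Suc n \<and> prefix x z) \<and>
        (\<exists>i<m. z = y @ [i])"
      by (intro exI[of _ "y @ [i]"]) (auto intro: child_in_m_tree)
  qed (use x in auto)
  then obtain y where y: "\<And>n. y n \<in> m_tree m" "\<And>n. Q (y n)" "\<And>n. length (y n) = length x + n"
    and Suc: "\<And>n. \<exists>i<m. y (Suc n) = y n @ [i]"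
    by blast
  have prefix: "prefix (y n) (y (n + j))" for n j
  proof (induction j)
    case (Suc j)
    then show ?case using Suc.IH \<open>\<And>n. \<exists>i<m. y (Suc n) = y n @ [i]\<close>[of "n + j"] by auto
  qed simp
  have nth: "y n ! i = y k ! i" if "i < length (y n)" "i < length (y k)" for n k i
  proof -
    have "prefix (y n) (y k) \<or> prefix (y k) (y n)"
      using prefix[of n "k - n"] prefix[of k "n - k"] by (cases "n \<le> k") auto
    then show ?thesis using that by (auto simp: prefix_def nth_append)
  qed
  let ?p = "\<lambda>i. y (Suc i) ! i"
  have "branch_vertex ?p (length x + n) = y n" for n
    by (rule nth_equalityI) (auto simp: branch_vertex_def y intro!: nth)
  then have "Q (branch_vertex ?p k)" if "k \<ge> length x" for k
    using that y(2)[of "k - length x"] by (metis le_add_diff_inverse)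
  moreover have "?p \<in> boundary m"
  proof -
    have "?p i < m" for i
      using y(1)[of "Suc i"] y(3)[of "Suc i"] by (auto simp: m_tree_def in_lists_conv_set)
    then show ?thesis by (auto simp: boundary_def)
  qed
  ultimately show thesis using that by blast
qed

lemma comparison_principle:
  assumes sub: "subsolution m u" and super: "supersolution m v"
    and u: "\<And>p. p \<in> boundary m \<Longrightarrow> (\<lambda>k. u (branch_vertex p k)) \<longlonglongrightarrow> f p"
    and v: "\<And>p. p \<in> boundary m \<Longrightarrow> (\<lambda>k. v (branch_vertex p k)) \<longlonglongrightarrow> f p"
    and x: "x \<in> m_tree m"
  shows "u x \<le> v x"
proof (rule ccontr)
  define w where "w = (\<lambda>y. u y - v y)"
  assume "\<not> u x \<le> v x"
  then have "w x > 0" by (simp add: w_def)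
  \<comment> \<open>Walk up from \<open>x\<close> for as long as the excess stays positive.\<close>
  have "\<exists>y \<in> m_tree m. w y > 0 \<and> (y = [] \<or> w (butlast y) \<le> w y)"
    using x \<open>w x > 0\<close>
  proof (induction x rule: rev_induct)
    case (snoc i x)
    show ?case
    proof (cases "w x > 0")
      case True
      with snoc show ?thesis by (auto simp: m_tree_def)
    next
      case False
      with snoc.prems show ?thesis by (intro bexI[of _ "x @ [i]"]) auto
    qed
  qed (auto intro: root_in_m_tree)
  then obtain y where y: "y \<in> m_tree m" "w y > 0" "y = [] \<or> w (butlast y) \<le> w y"
    by blast
  \<comment> \<open>The condition on the parent is part of the invariant since it is what lets the excess
      propagate further.\<close>
  obtain p where p: "p \<in> boundary m"
    and above: "\<And>k. k \<ge> length y \<Longrightarrow> w (branch_vertex p k) \<ge> w y"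
  proof (rule exists_branch_following[of y "\<lambda>z. w y \<le> w z \<and> (z = [] \<or> w (butlast z) \<le> w z)"])
    fix z assume "z \<in> m_tree m" "w y \<le> w z \<and> (z = [] \<or> w (butlast z) \<le> w z)"
    with excess_propagates_downwards[OF sub super, of z]
    show "\<exists>i<m. w y \<le> w (z @ [i]) \<and> (z @ [i] = [] \<or> w (butlast (z @ [i])) \<le> w (z @ [i]))"
      by (fastforce simp: w_def)
  qed (use y in auto)
  have "(\<lambda>k. w (branch_vertex p k)) \<longlonglongrightarrow> f p - f p"
    unfolding w_def using u[OF p] v[OF p] by (rule tendsto_diff)
  then have "w y \<le> f p - f p"
    by (rule LIMSEQ_le_const) (use above in blast)
  with y show False by simp
qed

section \<open>Barriers\<close>

lemma subtree_ramp_nonneg: "0 \<le> subtree_ramp m a x"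
  using m by (auto simp: subtree_ramp_def divide_simps)

lemma subtree_ramp_le_1: "subtree_ramp m a x \<le> 1"
  by (simp add: subtree_ramp_def)

text \<open>On a descending path that starts at \<open>a\<close> the ramp is the arc length, and the average with the
  parent is linear interpolation with respect to it.\<close>

lemma subtree_ramp_linear:
  assumes "strict_prefix a x"
  shows "subtree_ramp m a (butlast x) + real m * subtree_ramp m a (x @ [i])
    = (real m + 1) * subtree_ramp m a x"
proof -
  obtain y b where x: "x = y @ [b]" and y: "prefix a y"
    using assms by (metis prefix_snoc rev_exhaust strict_prefix_def strict_prefix_simps(1))
  define n where "n = length y - length a"
  have "length x - length a = Suc n" "length (x @ [i]) - length a = Suc (Suc n)"
    using prefix_length_le[OF y] by (auto simp: x n_def)
  moreover have "prefix a x" "prefix a (x @ [i])"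
    using y by (auto simp: x)
  ultimately show ?thesis
    using y m by (simp add: subtree_ramp_def x n_def[symmetric] field_simps)
qed

lemma subtree_ramp_child: "subtree_ramp m a x \<le> subtree_ramp m a (x @ [i])"
proof (cases "prefix a x")
  case True
  have "length x - length a \<le> length (x @ [i]) - length a"
    by simp
  then have "real m ^ (length x - length a) \<le> real m ^ (length (x @ [i]) - length a)"
    using m by (intro power_increasing) auto
  then have "1 / real m ^ (length (x @ [i]) - length a) \<le> 1 / real m ^ (length x - length a)"
    using m by (intro divide_left_mono) auto
  moreover have "prefix a (x @ [i])"
    using True by simp
  ultimately show ?thesis
    using True unfolding subtree_ramp_def by (simp only: if_True)
next
  case False
  then show ?thesis using subtree_ramp_nonneg[of a "x @ [i]"] by (simp add: subtree_ramp_def)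
qed

lemma subtree_ramp_eq_0: "\<not> strict_prefix a x \<Longrightarrow> subtree_ramp m a x = 0"
  by (cases "a = x") (auto simp: subtree_ramp_def strict_prefix_def)

text \<open>Strictly below \<open>a\<close> the average of the parent and a child attains the value of the barrier. At all
  other vertices the barrier takes its largest value \<open>M\<close>, so any average is small enough.\<close>

lemma upper_barrier_supersolution:
  assumes "V \<in> upper_barriers m f"
  shows "supersolution m V"
  unfolding supersolution_def
proof
  fix x assume "x \<in> m_tree m"
  obtain M D a where V: "V = (\<lambda>x. M - D * subtree_ramp m a x)" and D: "0 \<le> D"
    using assms by (auto simp: upper_barriers_def)
  show "tree_op m V x \<le> V x"
  proof (cases "strict_prefix a x")
    case True
    then have "x \<noteq> []" by auto
    have "(V (butlast x) + real m * V (x @ [0])) / (real m + 1) = V x"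
    proof -
      have "V (butlast x) + real m * V (x @ [0]) = (real m + 1) * M
          - D * (subtree_ramp m a (butlast x) + real m * subtree_ramp m a (x @ [0]))"
        by (simp add: V algebra_simps)
      also have "\<dots> = (real m + 1) * V x"
        by (simp add: subtree_ramp_linear[OF True] V algebra_simps)
      finally show ?thesis by simp
    qed
    with tree_op_le_pred[of 0 x V] \<open>x \<noteq> []\<close> m show ?thesis by simp
  next
    case False
    then have "V x = M" by (simp add: V subtree_ramp_eq_0)
    moreover have "V y \<le> M" for y using D subtree_ramp_nonneg by (simp add: V)
    note this[of "x @ [0]"] this[of "x @ [1]"]
    ultimately show ?thesis using tree_op_le_pair[of 0 1 V x] m by simp
  qed
qed

text \<open>The ramp does not decrease from a vertex to its children, which settles the averages of two
  children. With the parent there is equality strictly below \<open>a\<close>, and at all other vertices the ramp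
  vanishes, which is its least value.\<close>

lemma lower_barrier_subsolution:
  assumes "L \<in> lower_barriers m f"
  shows "subsolution m L"
  unfolding subsolution_def
proof
  fix x assume "x \<in> m_tree m"
  obtain C D a where L: "L = (\<lambda>x. C + D * subtree_ramp m a x)" and D: "0 \<le> D"
    using assms by (auto simp: lower_barriers_def)
  have child: "L x \<le> L (x @ [i])" for i
    using D subtree_ramp_child by (simp add: L mult_left_mono)
  have "L x \<le> (L (butlast x) + real m * L (x @ [i])) / (real m + 1)" for i
  proof -
    have "(real m + 1) * subtree_ramp m a x
        \<le> subtree_ramp m a (butlast x) + real m * subtree_ramp m a (x @ [i])"
      by (cases "strict_prefix a x")
        (simp_all add: subtree_ramp_linear subtree_ramp_eq_0 subtree_ramp_nonneg)
    then have "D * ((real m + 1) * subtree_ramp m a x)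
        \<le> D * (subtree_ramp m a (butlast x) + real m * subtree_ramp m a (x @ [i]))"
      using D by (rule mult_left_mono)
    then show ?thesis by (simp add: L field_simps)
  qed
  moreover have "L x \<le> (L (x @ [i]) + L (x @ [j])) / 2" for i j
    using child[of i] child[of j] by simp
  ultimately show "L x \<le> tree_op m L x" by (simp add: tree_op_ge_iff)
qed

text \<open>Upper barriers do not increase towards the boundary, so at \<open>x\<close> they are at least their limits at the
  branches through \<open>x\<close>. By symmetry a boundary value separates lower from upper barriers at every vertex.\<close>

lemma boundary_value_le_upper_barrier:
  assumes "V \<in> upper_barriers m f" "q \<in> boundary m" "passes_through q x"
  shows "f q \<le> V x"
proof -
  obtain M D a where V: "V = (\<lambda>x. M - D * subtree_ramp m a x)" and D: "0 \<le> D"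
    and f: "f q \<le> M" "passes_through q a \<Longrightarrow> f q \<le> M - D"
    using assms by (auto simp: upper_barriers_def)
  show ?thesis
  proof (cases "prefix a x")
    case True
    then have "f q \<le> M - D" using f(2) passes_through_prefix assms(3) by blast
    also have "\<dots> \<le> V x" using mult_left_mono[OF subtree_ramp_le_1[of a x] D] by (simp add: V)
    finally show ?thesis .
  next
    case False
    then show ?thesis using f by (simp add: V subtree_ramp_def)
  qed
qed

lemma uminus_lower_barrier:
  assumes "L \<in> lower_barriers m f"
  shows "(\<lambda>x. - L x) \<in> upper_barriers m (\<lambda>q. - f q)"
proof -
  obtain C D a where "L = (\<lambda>x. C + D * subtree_ramp m a x)" "0 \<le> D"
    "\<forall>q \<in> boundary m. C \<le> f q \<and> (passes_through q a \<longrightarrow> C + D \<le> f q)"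
    using assms by (auto simp: lower_barriers_def)
  then show ?thesis
    unfolding upper_barriers_def by (intro CollectI exI[of _ "-C"] exI[of _ D] exI[of _ a]) auto
qed

lemma lower_barrier_le_upper_barrier:
  assumes L: "L \<in> lower_barriers m f" and V: "V \<in> upper_barriers m f" and x: "x \<in> m_tree m"
  shows "L x \<le> V x"
proof -
  obtain q where q: "q \<in> boundary m" "passes_through q x"
    using exists_branch_through[OF x] .
  have "- f q \<le> - L x"
    using boundary_value_le_upper_barrier[OF uminus_lower_barrier[OF L] q] .
  moreover have "f q \<le> V x"
    using boundary_value_le_upper_barrier[OF V q] .
  ultimately show ?thesis by simp
qed

section \<open>Existence\<close>

text \<open>Perron's method. The boundedness of the data makes the constants \<open>-B\<close> and \<open>B\<close> barriers, so the
  supremum is over a nonempty set and finite. By monotonicity \<open>tree_op m u\<close> is again one of the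
  competitors, which gives the inequality that the supremum itself does not provide.\<close>

lemma exists_solution_between_barriers:
  assumes bounded: "\<And>q. q \<in> boundary m \<Longrightarrow> \<bar>f q\<bar> \<le> B"
  shows "\<exists>u. satisfies_equation m u
    \<and> (\<forall>V \<in> upper_barriers m f. \<forall>x \<in> m_tree m. u x \<le> V x)
    \<and> (\<forall>L \<in> lower_barriers m f. \<forall>x \<in> m_tree m. L x \<le> u x)"
proof -
  define S where "S = {v. subsolution m v \<and> (\<forall>V \<in> upper_barriers m f. \<forall>x \<in> m_tree m. v x \<le> V x)}"
  define u where "u x = (SUP v \<in> S. v x)" for x
  have lower_in_S: "L \<in> S" if "L \<in> lower_barriers m f" for L
    using that lower_barrier_subsolution lower_barrier_le_upper_barrier by (auto simp: S_def)
  have "(\<lambda>x. - B) \<in> lower_barriers m f"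
    unfolding lower_barriers_def
    by (intro CollectI exI[of _ "-B"] exI[of _ 0] exI[of _ "[]"])
      (use bounded in \<open>auto simp: abs_le_iff minus_le_iff\<close>)
  then have S_nonempty: "S \<noteq> {}" using lower_in_S by blast
  have "(\<lambda>x. B) \<in> upper_barriers m f"
    unfolding upper_barriers_def
    by (intro CollectI exI[of _ B] exI[of _ 0] exI[of _ "[]"])
      (use bounded in \<open>auto simp: abs_le_iff\<close>)
  then have bdd: "bdd_above ((\<lambda>v. v x) ` S)" if "x \<in> m_tree m" for x
    using that by (intro bdd_aboveI[of _ B]) (auto simp: S_def)
  have le_u: "v x \<le> u x" if "v \<in> S" "x \<in> m_tree m" for v x
    unfolding u_def using bdd that by (intro cSUP_upper)
  have u_le: "u x \<le> c" if "\<And>v. v \<in> S \<Longrightarrow> v x \<le> c" for x c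
    unfolding u_def using S_nonempty that by (intro cSUP_least)
  have u_upper: "u x \<le> V x" if "V \<in> upper_barriers m f" "x \<in> m_tree m" for V x
    using that by (intro u_le) (auto simp: S_def)
  have u_sub: "u x \<le> tree_op m u x" if x: "x \<in> m_tree m" for x
  proof (rule u_le)
    fix v assume v: "v \<in> S"
    then have "v x \<le> tree_op m v x" using x by (auto simp: S_def subsolution_def)
    also have "\<dots> \<le> tree_op m u x" using x le_u[OF v] by (rule tree_op_mono)
    finally show "v x \<le> tree_op m u x" .
  qed
  have "tree_op m u \<in> S"
    unfolding S_def subsolution_def
  proof (intro CollectI conjI ballI)
    fix x assume x: "x \<in> m_tree m"
    show "tree_op m u x \<le> tree_op m (tree_op m u) x"
      using x u_sub by (rule tree_op_mono)
    fix V assume V: "V \<in> upper_barriers m f"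
    have "tree_op m u x \<le> tree_op m V x"
      using x u_upper[OF V] by (rule tree_op_mono)
    also have "\<dots> \<le> V x"
      using upper_barrier_supersolution[OF V] x by (simp add: supersolution_def)
    finally show "tree_op m u x \<le> V x" .
  qed
  then have "satisfies_equation m u"
    unfolding satisfies_equation_iff_fixed_point using u_sub le_u by (blast intro: antisym)
  then show ?thesis using u_upper lower_in_S le_u by blast
qed

text \<open>The jump height \<open>2 * B\<close> of the barriers is large enough for them to clear the data on branches
  that avoid the subtree, where nothing is known but the bound \<open>B\<close>.\<close>

lemma between_barriers_boundary_limit:
  assumes bounded: "\<And>q. q \<in> boundary m \<Longrightarrow> \<bar>f q\<bar> \<le> B"
    and cont: "\<And>\<epsilon>. \<epsilon> > 0 \<Longrightarrow> \<exists>k. \<forall>q \<in> boundary m. branch_vertex q k = branch_vertex p k \<longrightarrow> \<bar>f q - f p\<bar> \<le> \<epsilon>"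
    and p: "p \<in> boundary m"
    and upper: "\<And>V x. V \<in> upper_barriers m f \<Longrightarrow> x \<in> m_tree m \<Longrightarrow> u x \<le> V x"
    and lower: "\<And>L x. L \<in> lower_barriers m f \<Longrightarrow> x \<in> m_tree m \<Longrightarrow> L x \<le> u x"
  shows "(\<lambda>k. u (branch_vertex p k)) \<longlonglongrightarrow> f p"
proof (rule LIMSEQ_I)
  fix r :: real assume "r > 0"
  define \<epsilon> where "\<epsilon> = r / 2"
  have "\<epsilon> > 0" using \<open>r > 0\<close> by (simp add: \<epsilon>_def)
  then obtain k where k: "\<And>q. q \<in> boundary m \<Longrightarrow> branch_vertex q k = branch_vertex p k \<Longrightarrow>
      \<bar>f q - f p\<bar> \<le> \<epsilon>"
    using cont by blast
  define a where "a = branch_vertex p k"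
  have a: "length a = k" by (simp add: a_def branch_vertex_def)
  have near: "\<bar>f q - f p\<bar> \<le> \<epsilon>" if "q \<in> boundary m" "passes_through q a" for q
    using that k[of q] by (simp add: passes_through_def a) (simp add: a_def)
  have "\<bar>f p\<bar> \<le> B" using bounded p by blast
  then have "B \<ge> 0" by simp
  let ?s = "subtree_ramp m a"
  have "(\<lambda>x. (f p + \<epsilon> + 2 * B) - 2 * B * ?s x) \<in> upper_barriers m f"
    unfolding upper_barriers_def
  proof (intro CollectI exI conjI ballI impI)
    fix q assume q: "q \<in> boundary m"
    show "f q \<le> f p + \<epsilon> + 2 * B"
      using bounded[OF q] \<open>\<bar>f p\<bar> \<le> B\<close> \<open>\<epsilon> > 0\<close> by linarith
    show "f q \<le> f p + \<epsilon> + 2 * B - 2 * B" if "passes_through q a"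
      using near[OF q that] by linarith
  qed (use \<open>B \<ge> 0\<close> in auto)
  note hi = upper[OF this branch_vertex_in_m_tree[OF p]]
  have "(\<lambda>x. (f p - \<epsilon> - 2 * B) + 2 * B * ?s x) \<in> lower_barriers m f"
    unfolding lower_barriers_def
  proof (intro CollectI exI conjI ballI impI)
    fix q assume q: "q \<in> boundary m"
    show "f p - \<epsilon> - 2 * B \<le> f q"
      using bounded[OF q] \<open>\<bar>f p\<bar> \<le> B\<close> \<open>\<epsilon> > 0\<close> by linarith
    show "f p - \<epsilon> - 2 * B + 2 * B \<le> f q" if "passes_through q a"
      using near[OF q that] by linarith
  qed (use \<open>B \<ge> 0\<close> in auto)
  note lo = lower[OF this branch_vertex_in_m_tree[OF p]]
  have "(\<lambda>n. 2 * B * (1 / real m) ^ n) \<longlonglongrightarrow> 2 * B * 0"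
    using m by (intro tendsto_mult tendsto_const LIMSEQ_power_zero) auto
  then have "\<forall>\<^sub>F n in sequentially. 2 * B * (1 / real m) ^ n < \<epsilon>"
    using \<open>\<epsilon> > 0\<close> by (intro order_tendstoD(2)) auto
  then obtain N where N: "\<And>n. n \<ge> N \<Longrightarrow> 2 * B * (1 / real m) ^ n < \<epsilon>"
    by (auto simp: eventually_sequentially)
  show "\<exists>n0. \<forall>n\<ge>n0. norm (u (branch_vertex p n) - f p) < r"
  proof (intro exI allI impI)
    fix n assume n: "n \<ge> k + N"
    have "prefix a (branch_vertex p n)"
      unfolding a_def using n by (intro prefix_branch_vertex) simp
    then have "?s (branch_vertex p n) = 1 - (1 / real m) ^ (n - k)"
      by (simp add: subtree_ramp_def a power_one_over) (simp add: branch_vertex_def)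
    then have "2 * B * ?s (branch_vertex p n) = 2 * B - 2 * B * (1 / real m) ^ (n - k)"
      by (simp add: right_diff_distrib)
    moreover have "2 * B * (1 / real m) ^ (n - k) < \<epsilon>"
      using n by (intro N) simp
    ultimately show "norm (u (branch_vertex p n) - f p) < r"
      using hi[of n] lo[of n] unfolding \<epsilon>_def real_norm_def by linarith
  qed
qed

section \<open>Continuity in the cylinder topology\<close>

lemma summable_psi:
  assumes "p \<in> boundary m"
  shows "summable (\<lambda>k. real (p k) / real m ^ Suc k)"
proof (rule summable_comparison_test'[of "\<lambda>k. (1 / real m) ^ k" 0])
  show "summable (\<lambda>k. (1 / real m) ^ k)"
    using m by (intro summable_geometric) auto
  fix k
  have "p k < m" using assms by (auto simp: boundary_def)
  with m show "norm (real (p k) / real m ^ Suc k) \<le> (1 / real m) ^ k"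
    by (simp add: power_one_over divide_simps)
qed

lemma digit_tail_sums: "(\<lambda>i. real (m - 1) / real m ^ Suc (i + k)) sums (1 / real m ^ k)"
proof -
  have "(\<lambda>i. (1 / real m) ^ i) sums (1 / (1 - 1 / real m))"
    using m by (intro geometric_sums) auto
  then have "(\<lambda>i. (real (m - 1) / real m ^ Suc k) * (1 / real m) ^ i)
      sums ((real (m - 1) / real m ^ Suc k) * (1 / (1 - 1 / real m)))"
    by (rule sums_mult)
  moreover have "(real (m - 1) / real m ^ Suc k) * (1 / (1 - 1 / real m)) = 1 / real m ^ k"
    using m by (simp add: field_simps of_nat_diff)
  moreover have "(real (m - 1) / real m ^ Suc k) * (1 / real m) ^ i
      = real (m - 1) / real m ^ Suc (i + k)" for i
    by (simp add: power_add power_one_over)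
  ultimately show ?thesis by simp
qed

text \<open>The tail of an expansion is largest when all its digits are \<open>m - 1\<close>.\<close>

lemma psi_tail:
  assumes p: "p \<in> boundary m"
  shows "psi m p - (\<Sum>i<k. real (p i) / real m ^ Suc i) \<in> {0..1 / real m ^ k}"
proof -
  have eq: "psi m p - (\<Sum>i<k. real (p i) / real m ^ Suc i)
      = (\<Sum>i. real (p (i + k)) / real m ^ Suc (i + k))"
    unfolding psi_def using suminf_split_initial_segment[OF summable_psi[OF p], of k] by simp
  have summable: "summable (\<lambda>i. real (p (i + k)) / real m ^ Suc (i + k))"
    using summable_psi[OF p] by (rule summable_ignore_initial_segment)
  have "(\<Sum>i. real (p (i + k)) / real m ^ Suc (i + k))
      \<le> (\<Sum>i. real (m - 1) / real m ^ Suc (i + k))"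
  proof (rule suminf_le[OF _ summable sums_summable[OF digit_tail_sums]])
    fix i
    have "p (i + k) < m" using p by (auto simp: boundary_def)
    then have "p (i + k) \<le> m - 1" by simp
    then show "real (p (i + k)) / real m ^ Suc (i + k) \<le> real (m - 1) / real m ^ Suc (i + k)"
      by (intro divide_right_mono) (simp_all only: of_nat_le_iff, simp)
  qed
  also have "\<dots> = 1 / real m ^ k"
    using digit_tail_sums by (rule sums_unique[symmetric])
  finally show ?thesis
    unfolding eq using suminf_nonneg[OF summable] by simp
qed

lemma psi_in_unit_interval: "p \<in> boundary m \<Longrightarrow> psi m p \<in> {0..1}"
  using psi_tail[of p 0] by simp

lemma psi_close:
  assumes "p \<in> boundary m" "q \<in> boundary m" "branch_vertex q k = branch_vertex p k"
  shows "\<bar>psi m q - psi m p\<bar> \<le> 1 / real m ^ k"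
proof -
  have "q i = p i" if "i < k" for i
    using assms(3) that by (simp add: branch_vertex_def)
  then have "(\<Sum>i<k. real (q i) / real m ^ Suc i) = (\<Sum>i<k. real (p i) / real m ^ Suc i)"
    by (intro sum.cong) auto
  with psi_tail[OF assms(1), of k] psi_tail[OF assms(2), of k] show ?thesis by auto
qed

lemma continuous_psi_cylinder:
  assumes g: "continuous_on {0..1} g" and p: "p \<in> boundary m" and "\<epsilon> > 0"
  shows "\<exists>k. \<forall>q \<in> boundary m. branch_vertex q k = branch_vertex p k \<longrightarrow>
    \<bar>g (psi m q) - g (psi m p)\<bar> \<le> (\<epsilon> :: real)"
proof -
  obtain d where "d > 0" and d: "\<And>t. t \<in> {0..1} \<Longrightarrow> dist t (psi m p) < d \<Longrightarrow>
      dist (g t) (g (psi m p)) < \<epsilon>"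
    using g psi_in_unit_interval[OF p] \<open>\<epsilon> > 0\<close> unfolding continuous_on_iff by metis
  obtain k where "(1 / real m) ^ k < d"
    using real_arch_pow_inv[OF \<open>d > 0\<close>, of "1 / real m"] m by auto
  then have k: "1 / real m ^ k < d" by (simp add: power_one_over)
  have "\<bar>g (psi m q) - g (psi m p)\<bar> \<le> \<epsilon>"
    if "q \<in> boundary m" "branch_vertex q k = branch_vertex p k" for q
    using d[OF psi_in_unit_interval[OF that(1)]] psi_close[OF p that] k
    by (simp add: dist_real_def)
  then show ?thesis by blast
qed

end

section \<open>The Dirichlet problem\<close>

theorem theorem1p2:
  fixes m :: nat and g :: "real \<Rightarrow> real"
  assumes "m \<ge> 2"
    and "continuous_on {0..1} g"
  shows "\<exists>!u. u \<in> m_tree m \<rightarrow>\<^sub>E (UNIV :: real set)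
    \<and> satisfies_equation m u \<and> attains_boundary_values m g u"
proof -
  define f where "f p = g (psi m p)" for p
  have "bounded (g ` {0..1})"
    using assms(2) by (intro compact_imp_bounded compact_continuous_image) auto
  then obtain B where "\<forall>t \<in> {0..1}. \<bar>g t\<bar> \<le> B"
    unfolding bounded_iff real_norm_def by blast
  then have bounded: "\<bar>f q\<bar> \<le> B" if "q \<in> boundary m" for q
    unfolding f_def using psi_in_unit_interval[OF assms(1) that] by blast
  obtain u where u: "satisfies_equation m u"
    and upper: "\<And>V x. V \<in> upper_barriers m f \<Longrightarrow> x \<in> m_tree m \<Longrightarrow> u x \<le> V x"
    and lower: "\<And>L x. L \<in> lower_barriers m f \<Longrightarrow> x \<in> m_tree m \<Longrightarrow> L x \<le> u x"
    using exists_solution_between_barriers[OF assms(1), of f B] bounded by blast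
  have lim: "(\<lambda>k. u (branch_vertex p k)) \<longlonglongrightarrow> g (psi m p)" if p: "p \<in> boundary m" for p
  proof -
    have "(\<lambda>k. u (branch_vertex p k)) \<longlonglongrightarrow> f p"
    proof (rule between_barriers_boundary_limit[OF assms(1), of f B])
      show "\<exists>k. \<forall>q \<in> boundary m. branch_vertex q k = branch_vertex p k \<longrightarrow> \<bar>f q - f p\<bar> \<le> \<epsilon>"
        if "\<epsilon> > 0" for \<epsilon>
        unfolding f_def using continuous_psi_cylinder[OF assms p that] .
    qed (use bounded p upper lower in auto)
    then show ?thesis by (simp only: f_def)
  qed
  show ?thesis
  proof (rule ex1I)
    show "restrict u (m_tree m) \<in> m_tree m \<rightarrow>\<^sub>E UNIV \<and> satisfies_equation m (restrict u (m_tree m))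
        \<and> attains_boundary_values m g (restrict u (m_tree m))"
    proof (intro conjI)
      show "satisfies_equation m (restrict u (m_tree m))"
        using u tree_op_cong[OF assms(1), of _ "restrict u (m_tree m)" u]
        by (simp add: satisfies_equation_iff_fixed_point)
      show "attains_boundary_values m g (restrict u (m_tree m))"
        using lim by (simp add: attains_boundary_values_def branch_vertex_in_m_tree)
    qed simp
  next
    fix v assume v: "v \<in> m_tree m \<rightarrow>\<^sub>E UNIV \<and> satisfies_equation m v
        \<and> attains_boundary_values m g v"
    then have "subsolution m v" "supersolution m v" "subsolution m u" "supersolution m u"
      using u by (auto simp: satisfies_equation_iff_fixed_point subsolution_def supersolution_def)
    moreover have v_lim: "(\<lambda>k. v (branch_vertex p k)) \<longlonglongrightarrow> g (psi m p)" if "p \<in> boundary m" for p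
      using v that by (auto simp: attains_boundary_values_def)
    ultimately have "v x = u x" if "x \<in> m_tree m" for x
      using comparison_principle[OF assms(1), of v u "\<lambda>p. g (psi m p)" x]
        comparison_principle[OF assms(1), of u v "\<lambda>p. g (psi m p)" x] that lim
      by (intro antisym) auto
    with v show "v = restrict u (m_tree m)"
      by (intro extensionalityI[of _ "m_tree m"]) (auto simp: PiE_def)
  qed
qed

end
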